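(* Let $S$ be an $n$-element set and let $\mathcal{A},\mathcal{B}$ be families of subsets of $S$ such that $(\mathcal{A},\mathcal{B})$ is a cancellative pair. Then $|\mathcal{A}||\mathcal{B}|\leq 2.2682^n$.
   Context: A pair $(\mathcal{A},\mathcal{B})$ of families of subsets of a finite set $S$ is called cancellative if (i) whenever $A,A'\in\mathcal{A}$ and $B\in\mathcal{B}$ satisfy $A\cup B=A'\cup B$, then $A=A'$; and (ii) whenever $A\in\mathcal{A}$ and $B,B'\in\mathcal{B}$ satisfy $A\cup B=A\cup B'$, then $B=B'$. *)

theory Defs
  imports Complex_Main
begin

definition cancellative_pair :: "'a set set \<Rightarrow> 'a set set \<Rightarrow> bool" where
  "cancellative_pair \<A> \<B> \<longleftrightarrow>
     (\<forall>A\<in>\<A>. \<forall>A'\<in>\<A>. \<forall>B\<in>\<B>. A \<union> B = A' \<union> B \<longrightarrow> A = A') \<and>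
     (\<forall>A\<in>\<A>. \<forall>B\<in>\<B>. \<forall>B'\<in>\<B>. A \<union> B = A \<union> B' \<longrightarrow> B = B')"

end

theory Submission
  imports Defs "HOL-Analysis.Analysis"
begin

text \<open>Give \<open>A\<close> the weight \<open>exp (l * card A)\<close> and let \<open>Z(F)\<close> be the total weight of a family \<open>F\<close>. For a suitable
  function \<open>C\<close> with \<open>C 0 = ln 2.2682\<close>, one shows \<open>Z(F) * Z(G) \<le> exp (n * C l)\<close> for all \<open>0 \<le> l \<le> ln 2\<close> and all
  cancellative pairs \<open>(F, G)\<close>, by induction on \<open>n\<close>. At \<open>l = ln 2\<close> this follows from \<open>card F * 2 ^ card B \<le> 2 ^ n\<close>
  for \<open>B \<in> G\<close>, since \<open>A \<mapsto> A - B\<close> is injective on \<open>F\<close>. The derivative of \<open>ln (Z(F) * Z(G))\<close> in \<open>l\<close> is the sum over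
  the points \<open>x\<close> of \<open>p x + q x\<close>, where \<open>p x\<close> and \<open>q x\<close> are the probabilities that \<open>x\<close> lies in a random member of \<open>F\<close> and of
  \<open>G\<close>. If the bound fails at some \<open>l\<close>, the induction hypothesis for the pairs obtained by deleting \<open>x\<close>
  forces \<open>p x\<close> and \<open>q x\<close> to be large, so the derivative is at least \<open>n * C' l\<close> and the violation persists up to \<open>ln 2\<close>, a
  contradiction. For \<open>exp l \<ge> 5/4\<close> the required lower bound also uses the entropy of the traces \<open>A - B\<close>; for
  \<open>exp l \<le> 5/4\<close> the deletion inequalities suffice.\<close>

section \<open>Weighted families and cancellative pairs\<close>

definition weight :: "real \<Rightarrow> 'a set set \<Rightarrow> real" where
  "weight l F = (\<Sum>A\<in>F. exp (l * card A))"

definition occupancy :: "real \<Rightarrow> 'a set set \<Rightarrow> 'a \<Rightarrow> real" where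
  "occupancy l F x = weight l {A \<in> F. x \<in> A} / weight l F"

text \<open>All pairs on \<open>S\<close> are quantified at once because deleting a point replaces
  both families.\<close>

definition pair_bound :: "'a set \<Rightarrow> real \<Rightarrow> real \<Rightarrow> bool" where
  "pair_bound S l c \<longleftrightarrow> (\<forall>F G. F \<subseteq> Pow S \<longrightarrow> G \<subseteq> Pow S \<longrightarrow> cancellative_pair F G \<longrightarrow>
     weight l F * weight l G \<le> exp (c * card S))"

lemma cancellative_pair_commute:
  assumes "cancellative_pair F G"
  shows "cancellative_pair G F"
  unfolding cancellative_pair_def
proof (intro conjI ballI impI)
  fix A A' B assume "A \<in> G" "A' \<in> G" "B \<in> F" "A \<union> B = A' \<union> B"
  moreover from this have "B \<union> A = B \<union> A'" by (simp only: Un_commute)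
  ultimately show "A = A'" using assms unfolding cancellative_pair_def by blast
next
  fix A B B' assume "A \<in> G" "B \<in> F" "B' \<in> F" "A \<union> B = A \<union> B'"
  moreover from this have "B \<union> A = B' \<union> A" by (simp only: Un_commute)
  ultimately show "B = B'" using assms unfolding cancellative_pair_def by blast
qed

lemma cancellative_pair_subset:
  "cancellative_pair F G \<Longrightarrow> F' \<subseteq> F \<Longrightarrow> G' \<subseteq> G \<Longrightarrow> cancellative_pair F' G'"
  unfolding cancellative_pair_def by (meson subsetD)

text \<open>The trace \<open>A - B\<close> determines \<open>A \<union> B\<close>, from which
  cancellation recovers \<open>A\<close>.\<close>

lemma cancellative_pair_inj_on_diff:
  assumes "cancellative_pair F G" "B \<in> G"
  shows "inj_on (\<lambda>A. A - B) F"
proof (rule inj_onI)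
  fix A A' assume "A \<in> F" "A' \<in> F" "A - B = A' - B"
  then have "A \<union> B = A' \<union> B" by blast
  with assms \<open>A \<in> F\<close> \<open>A' \<in> F\<close> show "A = A'"
    unfolding cancellative_pair_def by blast
qed

text \<open>Every retained member of the second family contains \<open>x\<close>, so equal unions of
  traces lift to equal unions of the original sets.\<close>

lemma cancellative_pair_delete:
  assumes "cancellative_pair F G"
  shows "cancellative_pair ((\<lambda>A. A - {x}) ` F) ((\<lambda>B. B - {x}) ` {B \<in> G. x \<in> B})"
proof -
  have 1: "A = A'" if "A \<in> F" "A' \<in> F" "B \<in> G" "x \<in> B"
    "(A - {x}) \<union> (B - {x}) = (A' - {x}) \<union> (B - {x})" for A A' B
  proof -
    have "A \<union> B = A' \<union> B" using that(4,5) by blast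
    then show ?thesis using assms that unfolding cancellative_pair_def by blast
  qed
  have 2: "B = B'" if "A \<in> F" "B \<in> G" "x \<in> B" "B' \<in> G" "x \<in> B'"
    "(A - {x}) \<union> (B - {x}) = (A - {x}) \<union> (B' - {x})" for A B B'
  proof -
    have "A \<union> B = A \<union> B'" using that by blast
    then show ?thesis using assms that unfolding cancellative_pair_def by blast
  qed
  show ?thesis
    unfolding cancellative_pair_def ball_simps(9)
  proof (intro conjI ballI impI)
    fix A A' B
    assume "A \<in> F" "A' \<in> F" "B \<in> {B \<in> G. x \<in> B}"
      "(A - {x}) \<union> (B - {x}) = (A' - {x}) \<union> (B - {x})"
    then show "A - {x} = A' - {x}" using 1[of A A' B] by simp
  next
    fix A B B'
    assume "A \<in> F" "B \<in> {B \<in> G. x \<in> B}" "B' \<in> {B \<in> G. x \<in> B}"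
      "(A - {x}) \<union> (B - {x}) = (A - {x}) \<union> (B' - {x})"
    then show "B - {x} = B' - {x}" using 2[of A B B'] by simp
  qed
qed

lemma pair_boundD:
  "pair_bound S l c \<Longrightarrow> F \<subseteq> Pow S \<Longrightarrow> G \<subseteq> Pow S \<Longrightarrow> cancellative_pair F G \<Longrightarrow>
    weight l F * weight l G \<le> exp (c * card S)"
  unfolding pair_bound_def by blast

section \<open>Weights under deletion of a point\<close>

lemma weight_pos: "finite F \<Longrightarrow> F \<noteq> {} \<Longrightarrow> 0 < weight l F"
  unfolding weight_def by (rule sum_pos) auto

lemma weight_nonneg: "0 \<le> weight l F"
  unfolding weight_def by (rule sum_nonneg) auto

lemma weight_empty [simp]: "weight l {} = 0"
  by (simp add: weight_def)

lemma weight_split: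
  assumes "finite F"
  shows "weight l F = weight l {A \<in> F. x \<notin> A} + weight l {A \<in> F. x \<in> A}"
  unfolding weight_def
  by (subst sum.union_disjoint [symmetric]) (use assms in \<open>auto intro: sum.cong\<close>)

lemma exp_card_delete:
  fixes c :: real
  assumes "finite S" "x \<in> S"
  shows "exp (c * card (S - {x})) = exp (- c) * exp (c * card S)"
proof -
  have "real (card S) = 1 + real (card (S - {x}))" by (subst card.remove[OF assms]) simp
  then show ?thesis by (simp only: exp_add[symmetric]) (simp add: algebra_simps)
qed

lemma weight_delete:
  assumes "finite S" "F \<subseteq> Pow S" "inj_on (\<lambda>A. A - {x}) F"
  shows "weight l ((\<lambda>A. A - {x}) ` F) =
    weight l {A \<in> F. x \<notin> A} + exp (- l) * weight l {A \<in> F. x \<in> A}"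
proof -
  have fin: "finite F" using assms finite_subset by blast
  have fA: "finite A" if "A \<in> F" for A using assms that finite_subset by blast
  have "weight l ((\<lambda>A. A - {x}) ` F) = (\<Sum>A\<in>F. exp (l * card (A - {x})))"
    unfolding weight_def by (simp add: sum.reindex[OF assms(3)])
  also have "\<dots> = (\<Sum>A\<in>{A \<in> F. x \<notin> A} \<union> {A \<in> F. x \<in> A}. exp (l * card (A - {x})))"
    by (rule sum.cong) auto
  also have "\<dots> = (\<Sum>A\<in>{A \<in> F. x \<notin> A}. exp (l * card (A - {x})))
      + (\<Sum>A\<in>{A \<in> F. x \<in> A}. exp (l * card (A - {x})))"
    by (rule sum.union_disjoint) (use fin in auto)
  also have "(\<Sum>A\<in>{A \<in> F. x \<notin> A}. exp (l * card (A - {x}))) = weight l {A \<in> F. x \<notin> A}"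
    unfolding weight_def by (rule sum.cong) auto
  also have "(\<Sum>A\<in>{A \<in> F. x \<in> A}. exp (l * card (A - {x}))) = exp (- l) * weight l {A \<in> F. x \<in> A}"
    unfolding weight_def sum_distrib_left
  proof (rule sum.cong, simp)
    fix A assume A: "A \<in> {A \<in> F. x \<in> A}"
    then show "exp (l * card (A - {x})) = exp (- l) * exp (l * card A)"
      by (intro exp_card_delete fA) auto
  qed
  finally show ?thesis .
qed

lemma occupancy_bounds:
  assumes "finite F"
  shows "0 \<le> occupancy l F x" "occupancy l F x \<le> 1"
proof -
  show "0 \<le> occupancy l F x" by (simp add: occupancy_def weight_nonneg)
  have "weight l {A \<in> F. x \<in> A} \<le> weight l F"
    using weight_split[OF assms, of l x] weight_nonneg[of l "{A \<in> F. x \<notin> A}"] by linarith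
  then show "occupancy l F x \<le> 1"
    using weight_nonneg[of l F] by (auto simp: occupancy_def divide_le_eq_1)
qed

lemma weight_mem:
  assumes "finite F" "F \<noteq> {}"
  shows "weight l {A \<in> F. x \<in> A} = occupancy l F x * weight l F"
    and "weight l {A \<in> F. x \<notin> A} = (1 - occupancy l F x) * weight l F"
proof -
  show 1: "weight l {A \<in> F. x \<in> A} = occupancy l F x * weight l F"
    using weight_pos[OF assms, of l] by (simp add: occupancy_def)
  show "weight l {A \<in> F. x \<notin> A} = (1 - occupancy l F x) * weight l F"
    using weight_split[OF assms(1), of l x] 1 by (simp add: algebra_simps)
qed

section \<open>Deletion inequalities at a violation of the bound\<close>

text \<open>The members avoiding \<open>x\<close> form a pair on \<open>S - {x}\<close>, where the
  allowed bound is smaller by the factor \<open>exp (- c)\<close>. Dividing by the full weight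
  product, which exceeds the bound on \<open>S\<close>, leaves the probabilities of avoiding
  \<open>x\<close>.\<close>

lemma pair_bound_deletion_zeros:
  assumes S: "finite S" "x \<in> S" and FG: "F \<subseteq> Pow S" "G \<subseteq> Pow S" "cancellative_pair F G"
    and ne: "F \<noteq> {}" "G \<noteq> {}"
    and IH: "pair_bound (S - {x}) l c"
    and big: "exp (c * card S) < weight l F * weight l G"
  shows "(1 - occupancy l F x) * (1 - occupancy l G x) \<le> exp (- c)"
proof -
  have fin: "finite F" "finite G" using S FG finite_subset by blast+
  have pos: "0 < weight l F * weight l G" using weight_pos fin ne by (simp add: weight_pos)
  have "weight l {A \<in> F. x \<notin> A} * weight l {A \<in> G. x \<notin> A} \<le> exp (c * card (S - {x}))"
    by (rule pair_boundD[OF IH _ _ cancellative_pair_subset[OF FG(3)]]) (use FG in auto)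
  moreover have "exp (c * card (S - {x})) = exp (- c) * exp (c * card S)"
    by (rule exp_card_delete[OF S])
  moreover have "exp (- c) * exp (c * card S) \<le> exp (- c) * (weight l F * weight l G)"
    using big by (intro mult_left_mono) auto
  moreover have "weight l {A \<in> F. x \<notin> A} * weight l {A \<in> G. x \<notin> A} =
      ((1 - occupancy l F x) * (1 - occupancy l G x)) * (weight l F * weight l G)"
    unfolding weight_mem(2)[OF fin(1) ne(1)] weight_mem(2)[OF fin(2) ne(2)] by (simp only: mult_ac)
  ultimately have "((1 - occupancy l F x) * (1 - occupancy l G x)) * (weight l F * weight l G)
      \<le> exp (- c) * (weight l F * weight l G)"
    by linarith
  then show ?thesis using pos by (simp only: mult_le_cancel_right_pos)
qed

text \<open>Here the bound on \<open>S - {x}\<close> is applied to the traces of all of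
  \<open>F\<close> and of those members of \<open>G\<close> that contain \<open>x\<close>. Each
  removed \<open>x\<close> costs a factor \<open>exp (- l)\<close>.\<close>

lemma pair_bound_deletion_one:
  assumes S: "finite S" "x \<in> S" and FG: "F \<subseteq> Pow S" "G \<subseteq> Pow S" "cancellative_pair F G"
    and ne: "F \<noteq> {}" "G \<noteq> {}"
    and IH: "pair_bound (S - {x}) l c"
    and big: "exp (c * card S) < weight l F * weight l G"
  shows "occupancy l G x * (1 - occupancy l F x * (1 - exp (- l))) \<le> exp l * exp (- c)"
proof (cases "{B \<in> G. x \<in> B} = {}")
  case True
  then have "occupancy l G x = 0" by (simp only: occupancy_def weight_empty)
  then show ?thesis by simp
next
  case False
  then obtain B where B: "B \<in> G" "x \<in> B" by blast
  have fin: "finite F" "finite G" using S FG finite_subset by blast+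
  have pos: "0 < weight l F * weight l G" using weight_pos fin ne by (simp add: weight_pos)
  \<comment> \<open>Traces that agree off \<open>x\<close> agree off \<open>B\<close>, because
    \<open>x \<in> B\<close>; the trace modulo \<open>B\<close> already determines the member of
    \<open>F\<close>.\<close>
  have injF: "inj_on (\<lambda>A. A - {x}) F"
  proof (rule inj_onI)
    fix A A' assume A: "A \<in> F" "A' \<in> F" "A - {x} = A' - {x}"
    then have "A - B = A' - B" using B by blast
    then show "A = A'"
      using cancellative_pair_inj_on_diff[OF FG(3) B(1)] A by (auto dest: inj_onD)
  qed
  have injG: "inj_on (\<lambda>A. A - {x}) {B \<in> G. x \<in> B}"
    by (rule inj_onI) blast
  have wG: "weight l ((\<lambda>A. A - {x}) ` {B \<in> G. x \<in> B}) = exp (- l) * (occupancy l G x * weight l G)"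
  proof -
    have e: "{A \<in> {B \<in> G. x \<in> B}. x \<notin> A} = {}" "{A \<in> {B \<in> G. x \<in> B}. x \<in> A} = {B \<in> G. x \<in> B}"
      by auto
    show ?thesis
      using weight_delete[OF S(1) _ injG, of l] FG weight_mem(1)[OF fin(2) ne(2), of l x]
      unfolding e by auto
  qed
  have wF: "weight l ((\<lambda>A. A - {x}) ` F) = (1 - occupancy l F x * (1 - exp (- l))) * weight l F"
    using weight_delete[OF S(1) FG(1) injF, of l] weight_mem[OF fin(1) ne(1), of l x]
    by (simp add: algebra_simps)
  have "weight l ((\<lambda>A. A - {x}) ` F) * weight l ((\<lambda>A. A - {x}) ` {B \<in> G. x \<in> B})
      \<le> exp (c * card (S - {x}))"
  proof -
    have "(\<lambda>A. A - {x}) ` F \<subseteq> Pow (S - {x})" "(\<lambda>A. A - {x}) ` {B \<in> G. x \<in> B} \<subseteq> Pow (S - {x})"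
      using FG by auto
    then show ?thesis
      using pair_boundD[OF IH _ _ cancellative_pair_delete[OF FG(3), of x]] by blast
  qed
  moreover have "exp (c * card (S - {x})) = exp (- c) * exp (c * card S)"
    by (rule exp_card_delete[OF S])
  moreover have "exp (- c) * exp (c * card S) \<le> exp (- c) * (weight l F * weight l G)"
    using big by (intro mult_left_mono) auto
  moreover have "weight l ((\<lambda>A. A - {x}) ` F) * weight l ((\<lambda>A. A - {x}) ` {B \<in> G. x \<in> B}) =
      (exp (- l) * (occupancy l G x * (1 - occupancy l F x * (1 - exp (- l))))) * (weight l F * weight l G)"
    unfolding wF wG by (simp only: mult_ac)
  ultimately have "(exp (- l) * (occupancy l G x * (1 - occupancy l F x * (1 - exp (- l))))) * (weight l F * weight l G)
      \<le> exp (- c) * (weight l F * weight l G)"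
    by linarith
  then have "exp (- l) * (occupancy l G x * (1 - occupancy l F x * (1 - exp (- l)))) \<le> exp (- c)"
    using pos by (simp only: mult_le_cancel_right_pos)
  then have "exp l * (exp (- l) * (occupancy l G x * (1 - occupancy l F x * (1 - exp (- l))))) \<le> exp l * exp (- c)"
    by (intro mult_left_mono) auto
  then show ?thesis by (simp add: mult.assoc[symmetric] exp_add[symmetric])
qed

section \<open>Derivative in the weight parameter and propagation of violations\<close>

lemma weighted_card_sum:
  fixes l :: real
  assumes "finite S" "F \<subseteq> Pow S"
  shows "(\<Sum>A\<in>F. exp (l * card A) * card A) = (\<Sum>x\<in>S. weight l {A \<in> F. x \<in> A})"
proof -
  have fin: "finite F" using assms finite_subset by blast
  have "(\<Sum>x\<in>S. weight l {A \<in> F. x \<in> A}) = (\<Sum>x\<in>S. \<Sum>A\<in>F. if x \<in> A then exp (l * card A) else 0)"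
    unfolding weight_def using fin by (simp add: sum.inter_filter)
  also have "\<dots> = (\<Sum>A\<in>F. \<Sum>x\<in>S. if x \<in> A then exp (l * card A) else 0)"
    by (rule sum.swap)
  also have "\<dots> = (\<Sum>A\<in>F. exp (l * card A) * card A)"
  proof (rule sum.cong, simp)
    fix A assume "A \<in> F"
    then have "{x \<in> S. x \<in> A} = A" using assms by auto
    then show "(\<Sum>x\<in>S. if x \<in> A then exp (l * card A) else 0) = exp (l * card A) * card A"
      using assms(1) by (simp add: sum.inter_filter[symmetric])
  qed
  finally show ?thesis ..
qed

text \<open>The logarithmic derivative of the partition function is the mean size of a random
  member; double counting of incidences turns it into a sum over points.\<close>

lemma ln_weight_has_derivative:
  assumes "finite S" "F \<subseteq> Pow S" "F \<noteq> {}"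
  shows "((\<lambda>l. ln (weight l F)) has_real_derivative (\<Sum>x\<in>S. occupancy l F x)) (at l)"
proof -
  have fin: "finite F" using assms finite_subset by blast
  have "((\<lambda>l. weight l F) has_real_derivative (\<Sum>A\<in>F. exp (l * card A) * card A)) (at l)"
    unfolding weight_def by (auto intro!: derivative_eq_intros sum.cong)
  from DERIV_chain2[where f = ln and g = "\<lambda>l. weight l F", OF DERIV_ln[OF weight_pos[OF fin assms(3)]] this]
  show ?thesis
    unfolding weighted_card_sum[OF assms(1,2)]
    by (simp add: occupancy_def sum_distrib_left divide_inverse mult.commute)
qed

text \<open>Up to the first point where \<open>g \<le> 0\<close> the function is positive, hence its
  derivative is nonnegative, and the mean value theorem excludes a drop to zero.\<close>

lemma excess_persists:
  fixes g g' :: "real \<Rightarrow> real"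
  assumes "a \<le> b" "0 < g a"
    and der: "\<And>l. a \<le> l \<Longrightarrow> l \<le> b \<Longrightarrow> (g has_real_derivative g' l) (at l)"
    and nonneg: "\<And>l. a \<le> l \<Longrightarrow> l \<le> b \<Longrightarrow> 0 < g l \<Longrightarrow> 0 \<le> g' l"
  shows "0 < g b"
proof (rule ccontr)
  assume "\<not> 0 < g b"
  define Z where "Z = {l \<in> {a..b}. g l \<le> 0}"
  have cont: "continuous_on {a..b} g"
    by (meson DERIV_continuous_on DERIV_subset atLeastAtMost_iff der subset_UNIV)
  have "closed Z" unfolding Z_def
    using continuous_closed_preimage[OF cont closed_atLeastAtMost, of "{..0}"]
    by (simp add: vimage_def Int_def)
  then have "compact Z"
    unfolding compact_eq_bounded_closed Z_def
    by (auto intro: bounded_subset[OF bounded_closed_interval])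
  moreover have "b \<in> Z" using assms(1) \<open>\<not> 0 < g b\<close> by (simp add: Z_def)
  ultimately obtain z where z: "z \<in> Z" "\<And>l. l \<in> Z \<Longrightarrow> z \<le> l"
    using compact_attains_inf[of Z] by blast
  have za: "a < z" using z(1) assms(2) by (cases "z = a") (auto simp: Z_def)
  have zb: "z \<le> b" "g z \<le> 0" using z(1) by (auto simp: Z_def)
  obtain w where w: "a < w" "w < z" "g z - g a = (z - a) * g' w"
    using MVT2[OF za, of g g'] der zb by force
  have "0 < g w" using z(2)[of w] w zb by (force simp: Z_def)
  then have "0 \<le> (z - a) * g' w" using nonneg[of w] w za zb by auto
  then show False using w zb assms(2) by linarith
qed

text \<open>If the derivative of \<open>ln (weight l F * weight l G)\<close> is at least \<open>card S * C' l\<close> whenever the bound fails,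
  then a violation at \<open>l\<close> propagates up to \<open>b\<close>.\<close>
lemma pair_bound_flow:
  fixes S :: "'a set" and C C' :: "real \<Rightarrow> real"
  assumes fin: "finite S"
    and end_bound: "\<And>S :: 'a set. finite S \<Longrightarrow> pair_bound S b (C b)"
    and der: "\<And>l. a \<le> l \<Longrightarrow> l \<le> b \<Longrightarrow> (C has_real_derivative C' l) (at l)"
    and step: "\<And>(S :: 'a set) F G l. finite S \<Longrightarrow> F \<subseteq> Pow S \<Longrightarrow> G \<subseteq> Pow S \<Longrightarrow> cancellative_pair F G \<Longrightarrow>
      F \<noteq> {} \<Longrightarrow> G \<noteq> {} \<Longrightarrow> a \<le> l \<Longrightarrow> l \<le> b \<Longrightarrow> (\<And>x. x \<in> S \<Longrightarrow> pair_bound (S - {x}) l (C l)) \<Longrightarrow>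
      exp (C l * card S) < weight l F * weight l G \<Longrightarrow>
      card S * C' l \<le> (\<Sum>x\<in>S. occupancy l F x + occupancy l G x)"
  shows "\<forall>l. a \<le> l \<and> l \<le> b \<longrightarrow> pair_bound S l (C l)"
  using fin
proof (induction S rule: finite_psubset_induct)
  case (psubset S)
  show ?case
  proof (intro allI impI, rule ccontr)
    fix l0 assume l0: "a \<le> l0 \<and> l0 \<le> b" and "\<not> pair_bound S l0 (C l0)"
    then obtain F G where FG: "F \<subseteq> Pow S" "G \<subseteq> Pow S" "cancellative_pair F G"
      and big: "exp (C l0 * card S) < weight l0 F * weight l0 G"
      unfolding pair_bound_def by (auto simp: not_le)
    have ne: "F \<noteq> {}" "G \<noteq> {}" using big by auto
    have finF: "finite F" "finite G"
      using FG(1,2) by (meson finite_Pow_iff finite_subset psubset.hyps)+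
    \<comment> \<open>The logarithm of the ratio of the weight product to the bound. The violating
      pair stays fixed while \<open>l\<close> varies.\<close>
    define g where "g l = ln (weight l F) + ln (weight l G) - C l * card S" for l
    have g_pos: "0 < g l \<longleftrightarrow> exp (C l * card S) < weight l F * weight l G" for l
    proof -
      have pos: "0 < weight l F" "0 < weight l G" using weight_pos finF ne by blast+
      then have "g l = ln (weight l F * weight l G) - C l * card S"
        unfolding g_def by (simp only: ln_mult_pos)
      moreover have "C l * card S < ln (weight l F * weight l G) \<longleftrightarrow>
          exp (C l * card S) < weight l F * weight l G"
        using pos by (subst exp_less_cancel_iff[symmetric]) simp
      ultimately show ?thesis by linarith
    qed
    have "0 < g b"
    proof (rule excess_persists[of l0 b g "\<lambda>l. (\<Sum>x\<in>S. occupancy l F x) + (\<Sum>x\<in>S. occupancy l G x) - C' l * card S"])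
      show "l0 \<le> b" using l0 by simp
      show "0 < g l0" using big by (simp only: g_pos)
      fix l assume l: "l0 \<le> l" "l \<le> b"
      show "(g has_real_derivative (\<Sum>x\<in>S. occupancy l F x) + (\<Sum>x\<in>S. occupancy l G x) - C' l * card S) (at l)"
        unfolding g_def
        by (intro DERIV_diff DERIV_add ln_weight_has_derivative DERIV_cmult_right der)
          (use psubset.hyps FG ne l l0 in auto)
      \<comment> \<open>The induction statement covers the whole interval, so the smaller sets are
        controlled at every intermediate \<open>l\<close>.\<close>
      have IH: "pair_bound (S - {x}) l (C l)" if "x \<in> S" for x
      proof -
        have "S - {x} \<subset> S" using that by blast
        then show ?thesis using psubset.IH l l0 by auto
      qed
      assume "0 < g l"
      then have "card S * C' l \<le> (\<Sum>x\<in>S. occupancy l F x + occupancy l G x)"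
        by (intro step[OF psubset.hyps(1) FG ne]) (use IH l l0 in \<open>auto simp: g_pos\<close>)
      then show "0 \<le> (\<Sum>x\<in>S. occupancy l F x) + (\<Sum>x\<in>S. occupancy l G x) - C' l * card S"
        by (simp add: sum.distrib mult.commute)
    qed
    then have "exp (C b * card S) < weight b F * weight b G" using g_pos by blast
    then show False using pair_boundD[OF end_bound[OF psubset.hyps(1)] FG] by simp
  qed
qed

section \<open>The endpoint \<open>l = ln 2\<close>\<close>

text \<open>Each weight is at most the number of members times \<open>2\<close> to the largest size.
  Exchanging the two powers matches each cardinality with a set of the other family, and each
  product is at most \<open>2 ^ card S\<close>.\<close>

lemma pair_bound_end:
  assumes "finite S"
  shows "pair_bound S (ln 2) (2 * ln 2)"
  unfolding pair_bound_def
proof (intro allI impI)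
  fix F G assume FG: "F \<subseteq> Pow S" "G \<subseteq> Pow S" "cancellative_pair F G"
  have e: "exp (ln 2 * card A) = 2 ^ card A" for A :: "'a set"
    by (subst mult.commute) (simp add: exp_of_nat_mult)
  have fin: "finite F" "finite G"
    using FG(1,2) assms by (meson finite_Pow_iff finite_subset)+
  \<comment> \<open>The sets \<open>A - B\<close> are distinct subsets of
    \<open>S - B\<close>.\<close>
  have proj: "real (card F) * 2 ^ card B \<le> 2 ^ card S"
    if FG: "F \<subseteq> Pow S" "G \<subseteq> Pow S" "cancellative_pair F G" and B: "B \<in> G" for F G B
  proof -
    have BS: "B \<subseteq> S" using FG B by auto
    have "card F = card ((\<lambda>A. A - B) ` F)"
      using cancellative_pair_inj_on_diff[OF FG(3) B] by (simp add: card_image)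
    also have "\<dots> \<le> card (Pow (S - B))"
      by (rule card_mono) (use assms FG in auto)
    also have "\<dots> = 2 ^ card (S - B)" using assms by (simp add: card_Pow)
    finally have "card F * 2 ^ card B \<le> 2 ^ (card (S - B) + card B)"
      by (simp add: power_add)
    moreover have "card (S - B) + card B = card S"
      using BS assms by (simp add: card_Diff_subset finite_subset card_mono)
    ultimately have "real (card F * 2 ^ card B) \<le> real (2 ^ card S)"
      by (simp only: of_nat_le_iff)
    then show ?thesis by simp
  qed
  have max: "\<exists>A\<in>H. \<forall>A'\<in>H. card A' \<le> card A" if "finite H" "H \<noteq> {}" for H :: "'a set set"
  proof -
    have "Max (card ` H) \<in> card ` H" using that by (intro Max_in) auto
    then obtain A where "A \<in> H" "card A = Max (card ` H)" by auto
    then show ?thesis using that(1) by (metis Max_ge finite_imageI image_eqI)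
  qed
  show "weight (ln 2) F * weight (ln 2) G \<le> exp (2 * ln 2 * card S)"
  proof (cases "F = {} \<or> G = {}")
    case True then show ?thesis by auto
  next
    case False
    obtain A where A: "A \<in> F" "\<And>A'. A' \<in> F \<Longrightarrow> card A' \<le> card A"
      using max[of F] False fin by blast
    obtain B where B: "B \<in> G" "\<And>B'. B' \<in> G \<Longrightarrow> card B' \<le> card B"
      using max[of G] False fin by blast
    have w: "weight (ln 2) F \<le> real (card F) * 2 ^ card A" "weight (ln 2) G \<le> real (card G) * 2 ^ card B"
      unfolding weight_def e using A B by (intro sum_bounded_above; simp)+
    have "weight (ln 2) F * weight (ln 2) G \<le> (real (card F) * 2 ^ card A) * (real (card G) * 2 ^ card B)"
      using w by (intro mult_mono) (auto simp: weight_nonneg)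
    also have "\<dots> = (real (card F) * 2 ^ card B) * (real (card G) * 2 ^ card A)" by simp
    also have "\<dots> \<le> 2 ^ card S * 2 ^ card S"
    proof (rule mult_mono)
      show "real (card F) * 2 ^ card B \<le> 2 ^ card S" using proj[OF FG B(1)] .
      have "cancellative_pair G F" using FG(3) by (rule cancellative_pair_commute)
      then show "real (card G) * 2 ^ card A \<le> 2 ^ card S" using proj[OF FG(2,1) _ A(1)] by blast
    qed auto
    also have "\<dots> = exp (ln 2 * card S) * exp (ln 2 * card S)" by (simp only: e)
    also have "\<dots> = exp (2 * ln 2 * card S)" by (simp only: exp_add[symmetric]) simp
    finally show ?thesis .
  qed
qed

section \<open>Entropy estimates\<close>

text \<open>Binary entropy in natural units; it is \<open>0\<close> at both endpoints, where
  \<open>ln 0\<close> is multiplied by \<open>0\<close>.\<close>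

definition entropy :: "real \<Rightarrow> real" where
  "entropy p = - (p * ln p) - (1 - p) * ln (1 - p)"

text \<open>The left side is the tangent at \<open>1/2\<close>. The difference has derivative
  \<open>(2 * x - 1)\<^sup>2 / (x * (1 - x))\<close>.\<close>

lemma ln_diff_ge:
  fixes p :: real
  assumes "1/2 \<le> p" "p < 1"
  shows "4 * p - 2 \<le> ln p - ln (1 - p)"
proof -
  have "ln (1/2) - ln (1 - 1/2) - 4 * (1/2) \<le> ln p - ln (1 - p) - 4 * p"
  proof (rule DERIV_nonneg_imp_nondecreasing[OF assms(1)])
    fix x :: real assume x: "1/2 \<le> x" "x \<le> p"
    have "((\<lambda>x. ln x - ln (1 - x) - 4 * x) has_real_derivative 1 / x + 1 / (1 - x) - 4) (at x)"
      using x assms by (auto intro!: derivative_eq_intros)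
    moreover have "1 / x + 1 / (1 - x) - 4 = (2 * x - 1)\<^sup>2 / (x * (1 - x))"
      using x assms by (simp add: field_simps power2_eq_square)
    moreover have "0 \<le> (2 * x - 1)\<^sup>2 / (x * (1 - x))"
      using x assms by simp
    ultimately show "\<exists>y. ((\<lambda>x. ln x - ln (1 - x) - 4 * x) has_real_derivative y) (at x) \<and> 0 \<le> y"
      by auto
  qed
  then show ?thesis by simp
qed

lemma half_le_ln2: "1/2 \<le> ln (2::real)"
  using exp_half_le2 by (subst ln_ge_iff) auto

text \<open>The parabola touches the entropy at \<open>1/2\<close> with the same second derivative.
  To the right of \<open>1/2\<close> the gap grows by the tangent estimate for the log-odds;
  symmetry covers the left.\<close>

lemma entropy_le:
  assumes "0 \<le> p" "p \<le> 1"
  shows "entropy p \<le> ln 2 - 1/2 + 2 * p * (1 - p)"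
proof -
  have *: "entropy p \<le> ln 2 - 1/2 + 2 * p * (1 - p)" if p: "1/2 \<le> p" "p \<le> 1" for p
  \<comment> \<open>The derivative argument breaks down at \<open>1\<close>, where the claim is
    \<open>1/2 \<le> ln 2\<close>.\<close>
  proof (cases "p = 1")
    case True
    then show ?thesis using half_le_ln2 by (simp add: entropy_def)
  next
    case False
    let ?g = "\<lambda>x. 2 * x * (1 - x) + x * ln x + (1 - x) * ln (1 - x)"
    have "?g (1/2) \<le> ?g p"
    proof (rule DERIV_nonneg_imp_nondecreasing[OF p(1)])
      fix x :: real assume x: "1/2 \<le> x" "x \<le> p"
      have "(?g has_real_derivative 2 * (1 - x) - 2 * x + (ln x + (1 / x) * x)
          + (- ln (1 - x) - (1 / (1 - x)) * (1 - x))) (at x)"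
        using x p False by (auto intro!: derivative_eq_intros)
      moreover have "(1 / x) * x = 1" "(1 / (1 - x)) * (1 - x) = 1"
        using x p False by auto
      ultimately have "(?g has_real_derivative ln x - ln (1 - x) - (4 * x - 2)) (at x)"
        by (simp only:) (simp add: algebra_simps)
      then show "\<exists>y. (?g has_real_derivative y) (at x) \<and> 0 \<le> y"
        using ln_diff_ge[of x] x p False by fastforce
    qed
    then show ?thesis by (simp add: entropy_def ln_div)
  qed
  show ?thesis
  proof (cases "1/2 \<le> p")
    case True then show ?thesis using * assms by blast
  next
    case False
    have "entropy p = entropy (1 - p)" by (simp add: entropy_def)
    then show ?thesis using *[of "1 - p"] False assms by (simp add: algebra_simps)
  qed
qed

lemma sum_occupancy:
  fixes l :: real
  assumes "finite S" "F \<subseteq> Pow S"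
  shows "(\<Sum>A\<in>F. exp (l * card A) / weight l F * card A) = (\<Sum>x\<in>S. occupancy l F x)"
  using weighted_card_sum[OF assms, of l]
  by (simp add: occupancy_def sum_divide_distrib[symmetric])

lemma sum_if_mem:
  fixes l a b :: real
  assumes "finite F" "F \<noteq> {}"
  shows "(\<Sum>A\<in>F. exp (l * card A) / weight l F * (if x \<in> A then a else b)) =
    occupancy l F x * a + (1 - occupancy l F x) * b"
proof -
  have "(\<Sum>A\<in>F. exp (l * card A) / weight l F * (if x \<in> A then a else b)) =
      (\<Sum>A\<in>F. if x \<in> A then exp (l * card A) * (a / weight l F) else exp (l * card A) * (b / weight l F))"
    by (rule sum.cong) auto
  also have "\<dots> = (\<Sum>A\<in>{A \<in> F. x \<in> A}. exp (l * card A) * (a / weight l F))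
      + (\<Sum>A\<in>{A \<in> F. x \<notin> A}. exp (l * card A) * (b / weight l F))"
    using assms(1) by (simp add: sum.If_cases Int_def Collect_neg_eq[symmetric])
  also have "\<dots> = weight l {A \<in> F. x \<in> A} * (a / weight l F) + weight l {A \<in> F. x \<notin> A} * (b / weight l F)"
    unfolding weight_def[of l "{A \<in> F. x \<in> A}"] weight_def[of l "{A \<in> F. x \<notin> A}"]
    by (simp only: sum_distrib_right)
  also have "\<dots> = occupancy l F x * a + (1 - occupancy l F x) * b"
    using weight_pos[OF assms, of l] by (simp only: weight_mem[OF assms]) simp
  finally show ?thesis .
qed

text \<open>Gibbs' inequality for the law of \<open>A\<close> weighted by \<open>exp (l * card A)\<close> against the product law with
  the same marginals on \<open>S - B\<close>, where the traces \<open>A - B\<close> are distinct.\<close>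
lemma ln_weight_le_entropy:
  assumes S: "finite S" and F: "F \<subseteq> Pow S" "F \<noteq> {}" and inj: "inj_on (\<lambda>A. A - B) F"
  shows "ln (weight l F) \<le>
    (\<Sum>x\<in>S. if x \<in> B then 0 else entropy (occupancy l F x)) + l * (\<Sum>x\<in>S. occupancy l F x)"
proof -
  define W where "W = weight l F"
  define p where "p = occupancy l F"
  define \<mu> where "\<mu> A = exp (l * card A) / W" for A :: "'a set"
  define N where "N X = (\<Prod>x\<in>X. p x) * (\<Prod>x\<in>S - B - X. 1 - p x)" for X
  have fin: "finite F" using S F(1) by (meson finite_Pow_iff finite_subset)
  have W: "0 < W" unfolding W_def by (rule weight_pos[OF fin F(2)])
  have \<mu>: "0 < \<mu> A" for A using W by (simp add: \<mu>_def)
  have p01: "0 \<le> p x" "p x \<le> 1" for x unfolding p_def using occupancy_bounds[OF fin] by auto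
  \<comment> \<open>Only logarithms of positive numbers occur below: \<open>A\<close> itself
    contributes positive weight to the event that \<open>x\<close> is, or is not, a member.\<close>
  have p_pos: "0 < p x" if "A \<in> F" "x \<in> A" for A x
  proof -
    have "0 < weight l {A \<in> F. x \<in> A}" by (rule weight_pos) (use fin that in auto)
    then show ?thesis using W unfolding p_def occupancy_def W_def by simp
  qed
  have p_less: "p x < 1" if "A \<in> F" "x \<notin> A" for A x
  proof -
    have "0 < weight l {A \<in> F. x \<notin> A}" by (rule weight_pos) (use fin that in auto)
    then show ?thesis
      using W unfolding weight_mem(2)[OF fin F(2)] p_def W_def by (simp add: zero_less_mult_iff)
  qed
  have N_pos: "0 < N (A - B)" if "A \<in> F" for A
    unfolding N_def by (intro mult_pos_pos prod_pos) (use that p_pos p_less in auto)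
  have ln_N: "ln (N (A - B)) = (\<Sum>x\<in>S - B. if x \<in> A then ln (p x) else ln (1 - p x))" if A: "A \<in> F" for A
  proof -
    have AS: "A - B \<subseteq> S - B" "finite (S - B)" using A F(1) S by auto
    have "N (A - B) = (\<Prod>x\<in>S - B. if x \<in> A then p x else 1 - p x)"
    proof -
      have "(\<Prod>x\<in>S - B. if x \<in> A then p x else 1 - p x) =
          (\<Prod>x\<in>S - B - (A - B). if x \<in> A then p x else 1 - p x) *
          (\<Prod>x\<in>A - B. if x \<in> A then p x else 1 - p x)"
        by (rule prod.subset_diff[OF AS])
      also have "\<dots> = (\<Prod>x\<in>S - B - (A - B). 1 - p x) * (\<Prod>x\<in>A - B. p x)"
        by (intro arg_cong2[where f = "(*)"] prod.cong) auto
      finally show ?thesis by (simp add: N_def mult.commute)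
    qed
    moreover have "ln (\<Prod>x\<in>S - B. if x \<in> A then p x else 1 - p x) =
        (\<Sum>x\<in>S - B. ln (if x \<in> A then p x else 1 - p x))"
    proof (rule ln_prod[OF AS(2)])
      fix x assume "x \<in> S - B"
      show "(if x \<in> A then p x else 1 - p x) \<noteq> 0"
        using p_pos[OF A, of x] p_less[OF A, of x] by auto
    qed
    ultimately show ?thesis by (simp only: if_distrib[of ln])
  qed
  \<comment> \<open>Distinct traces are disjoint events of the product law on subsets of
    \<open>S - B\<close>, whose total mass is \<open>1\<close>.\<close>
  have sum_N: "(\<Sum>A\<in>F. N (A - B)) \<le> 1"
  proof -
    have "(\<Sum>A\<in>F. N (A - B)) = (\<Sum>X\<in>(\<lambda>A. A - B) ` F. N X)"
      by (simp add: sum.reindex[OF inj])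
    also have "\<dots> \<le> (\<Sum>X\<in>Pow (S - B). N X)"
      by (rule sum_mono2) (use S F(1) p01 in \<open>auto simp: N_def intro!: mult_nonneg_nonneg prod_nonneg\<close>)
    also have "\<dots> = (\<Prod>x\<in>S - B. p x + (1 - p x))"
      unfolding N_def by (rule prod_add[symmetric]) (use S in auto)
    finally show ?thesis by simp
  qed
  have sum_\<mu>: "(\<Sum>A\<in>F. \<mu> A) = 1"
    using W by (simp add: \<mu>_def W_def weight_def sum_divide_distrib[symmetric])
  have "\<mu> A * ln (N (A - B)) - \<mu> A * (l * card A - ln W) \<le> N (A - B) - \<mu> A" if "A \<in> F" for A
  proof -
    have "ln (N (A - B) / \<mu> A) \<le> N (A - B) / \<mu> A - 1"
      by (rule ln_le_minus_one) (use N_pos[OF that] \<mu> in auto)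
    moreover have "ln (N (A - B) / \<mu> A) = ln (N (A - B)) - (l * card A - ln W)"
      using N_pos[OF that] \<mu>[of A] W by (simp add: ln_div ln_mult_pos \<mu>_def)
    ultimately have "\<mu> A * (ln (N (A - B)) - (l * card A - ln W)) \<le> \<mu> A * (N (A - B) / \<mu> A - 1)"
      using \<mu>[of A] by (intro mult_left_mono) auto
    then show ?thesis using \<mu>[of A] by (simp add: right_diff_distrib)
  qed
  then have "(\<Sum>A\<in>F. \<mu> A * ln (N (A - B)) - \<mu> A * (l * card A - ln W)) \<le> (\<Sum>A\<in>F. N (A - B) - \<mu> A)"
    by (rule sum_mono)
  then have 1: "(\<Sum>A\<in>F. \<mu> A * ln (N (A - B))) - (\<Sum>A\<in>F. \<mu> A * (l * card A - ln W)) \<le> 0"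
    using sum_N sum_\<mu> by (simp add: sum_subtractf)
  have "(\<Sum>A\<in>F. \<mu> A * (l * card A - ln W)) = l * (\<Sum>A\<in>F. \<mu> A * card A) - ln W * (\<Sum>A\<in>F. \<mu> A)"
    by (simp add: right_diff_distrib sum_subtractf sum_distrib_left mult_ac)
  then have 2: "(\<Sum>A\<in>F. \<mu> A * (l * card A - ln W)) = l * (\<Sum>x\<in>S. p x) - ln W"
    using sum_\<mu> sum_occupancy[OF S F(1), of l] by (simp add: \<mu>_def W_def p_def)
  have "(\<Sum>A\<in>F. \<mu> A * ln (N (A - B))) =
      (\<Sum>A\<in>F. \<Sum>x\<in>S - B. \<mu> A * (if x \<in> A then ln (p x) else ln (1 - p x)))"
    by (intro sum.cong refl) (simp only: ln_N sum_distrib_left)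
  also have "\<dots> = (\<Sum>x\<in>S - B. \<Sum>A\<in>F. \<mu> A * (if x \<in> A then ln (p x) else ln (1 - p x)))"
    by (rule sum.swap)
  also have "\<dots> = (\<Sum>x\<in>S - B. p x * ln (p x) + (1 - p x) * ln (1 - p x))"
    unfolding \<mu>_def W_def p_def by (simp only: sum_if_mem[OF fin F(2)])
  also have "\<dots> = - (\<Sum>x\<in>S - B. entropy (p x))"
    by (simp add: entropy_def sum_negf[symmetric] add.commute)
  finally have 3: "(\<Sum>A\<in>F. \<mu> A * ln (N (A - B))) = - (\<Sum>x\<in>S - B. entropy (p x))" .
  have "(\<Sum>x\<in>S. if x \<in> B then 0 else entropy (p x)) = (\<Sum>x\<in>S - B. entropy (p x))"
    using S by (simp add: sum.If_cases set_diff_eq Int_def Collect_neg_eq[symmetric])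
  then show ?thesis using 1 2 3 unfolding p_def W_def by linarith
qed

text \<open>Averaging the bound for a fixed \<open>B\<close> over a random member of
  \<open>G\<close>: the entropy at \<open>x\<close> counts only when \<open>x \<notin> B\<close>,
  which has probability \<open>1 - occupancy l G x\<close>.\<close>

lemma ln_weight_le_entropy_average:
  assumes S: "finite S" and FG: "F \<subseteq> Pow S" "G \<subseteq> Pow S" "cancellative_pair F G"
    and ne: "F \<noteq> {}" "G \<noteq> {}"
  shows "ln (weight l F) \<le>
    (\<Sum>x\<in>S. (1 - occupancy l G x) * entropy (occupancy l F x) + l * occupancy l F x)"
proof -
  have fin: "finite G" using S FG(2) by (meson finite_Pow_iff finite_subset)
  define \<mu> where "\<mu> B = exp (l * card B) / weight l G" for B :: "'a set"
  have W: "0 < weight l G" by (rule weight_pos[OF fin ne(2)])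
  have sum_\<mu>: "(\<Sum>B\<in>G. \<mu> B) = 1"
    using W by (simp add: \<mu>_def weight_def sum_divide_distrib[symmetric])
  define E where "E B = (\<Sum>x\<in>S. if x \<in> B then 0 else entropy (occupancy l F x))" for B
  have "(\<Sum>B\<in>G. \<mu> B * ln (weight l F)) \<le> (\<Sum>B\<in>G. \<mu> B * (E B + l * (\<Sum>x\<in>S. occupancy l F x)))"
    unfolding E_def
    by (intro sum_mono mult_left_mono ln_weight_le_entropy S FG ne cancellative_pair_inj_on_diff[OF FG(3)])
      (use W in \<open>auto simp: \<mu>_def\<close>)
  also have "\<dots> = (\<Sum>B\<in>G. \<mu> B * E B) + l * (\<Sum>x\<in>S. occupancy l F x)"
    by (simp only: distrib_left sum.distrib sum_distrib_right[symmetric] sum_\<mu> mult_1)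
  also have "(\<Sum>B\<in>G. \<mu> B * E B) =
      (\<Sum>x\<in>S. \<Sum>B\<in>G. \<mu> B * (if x \<in> B then 0 else entropy (occupancy l F x)))"
    unfolding E_def sum_distrib_left by (rule sum.swap)
  also have "\<dots> = (\<Sum>x\<in>S. (1 - occupancy l G x) * entropy (occupancy l F x))"
    unfolding \<mu>_def by (simp only: sum_if_mem[OF fin ne(2)] mult_zero_right add_0_left)
  finally show ?thesis
    by (simp only: sum_distrib_right[symmetric] sum_\<mu> mult_1 sum.distrib sum_distrib_left)
qed

text \<open>Add the averaged bounds for both orders and replace entropy by its quadratic majorant.
  The quadratic parts combine to \<open>2 * (1 - p) * (1 - q) * (p + q)\<close>, so \<open>K\<close>
  makes the estimate linear in \<open>p + q\<close>.\<close>

lemma ln_weight_pair_le: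
  assumes S: "finite S" and FG: "F \<subseteq> Pow S" "G \<subseteq> Pow S" "cancellative_pair F G"
    and ne: "F \<noteq> {}" "G \<noteq> {}"
    and K: "\<And>x. x \<in> S \<Longrightarrow> (1 - occupancy l F x) * (1 - occupancy l G x) \<le> K"
  shows "ln (weight l F) + ln (weight l G) \<le> (2 * ln 2 - 1) * card S
    + (2 * K + l - (ln 2 - 1/2)) * (\<Sum>x\<in>S. occupancy l F x + occupancy l G x)"
proof -
  have fin: "finite F" "finite G" using S FG(1,2) by (meson finite_Pow_iff finite_subset)+
  have "ln (weight l F) + ln (weight l G) \<le>
      (\<Sum>x\<in>S. (1 - occupancy l G x) * entropy (occupancy l F x) + l * occupancy l F x) +
      (\<Sum>x\<in>S. (1 - occupancy l F x) * entropy (occupancy l G x) + l * occupancy l G x)"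
    using ln_weight_le_entropy_average[OF S FG ne, of l]
      ln_weight_le_entropy_average[OF S FG(2,1) cancellative_pair_commute[OF FG(3)] ne(2,1), of l]
    by linarith
  also have "\<dots> \<le> (\<Sum>x\<in>S. (2 * ln 2 - 1) + (2 * K + l - (ln 2 - 1/2)) * (occupancy l F x + occupancy l G x))"
    unfolding sum.distrib[symmetric]
  proof (rule sum_mono)
    fix x assume x: "x \<in> S"
    define p where "p = occupancy l F x"
    define q where "q = occupancy l G x"
    have pq: "0 \<le> p" "p \<le> 1" "0 \<le> q" "q \<le> 1"
      unfolding p_def q_def using occupancy_bounds[OF fin(1)] occupancy_bounds[OF fin(2)] by auto
    have "(1 - q) * entropy p \<le> (1 - q) * (ln 2 - 1/2 + 2 * p * (1 - p))"
      "(1 - p) * entropy q \<le> (1 - p) * (ln 2 - 1/2 + 2 * q * (1 - q))"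
      using pq by (auto intro!: mult_left_mono entropy_le)
    moreover have "((1 - p) * (1 - q)) * (p + q) \<le> K * (p + q)"
      using K[OF x] pq unfolding p_def q_def by (intro mult_right_mono) auto
    moreover have "(1 - q) * (ln 2 - 1/2 + 2 * p * (1 - p)) + (1 - p) * (ln 2 - 1/2 + 2 * q * (1 - q))
      = (ln 2 - 1/2) * (2 - (p + q)) + 2 * (((1 - p) * (1 - q)) * (p + q))" by algebra
    ultimately have "(1 - q) * entropy p + l * p + ((1 - p) * entropy q + l * q) \<le>
        (ln 2 - 1/2) * (2 - (p + q)) + 2 * (K * (p + q)) + l * (p + q)"
      by (simp only: distrib_left)
    also have "\<dots> = (2 * ln 2 - 1) + (2 * K + l - (ln 2 - 1/2)) * (p + q)" by algebra
    finally show "(1 - occupancy l G x) * entropy (occupancy l F x) + l * occupancy l F x +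
        ((1 - occupancy l F x) * entropy (occupancy l G x) + l * occupancy l G x)
        \<le> (2 * ln 2 - 1) + (2 * K + l - (ln 2 - 1/2)) * (occupancy l F x + occupancy l G x)"
      unfolding p_def q_def .
  qed
  also have "\<dots> = (2 * ln 2 - 1) * card S
    + (2 * K + l - (ln 2 - 1/2)) * (\<Sum>x\<in>S. occupancy l F x + occupancy l G x)"
    by (simp only: sum.distrib sum_distrib_left[symmetric]) simp
  finally show ?thesis .
qed

text \<open>A violation bounds the log-weight sum below, and \<open>ln_weight_pair_le\<close> with
  \<open>K = exp (- c)\<close> bounds it above; solving for the occupancy sum gives the claim. The
  slope \<open>d\<close> is meant to be the derivative of the exponent.\<close>

lemma occupancy_sum_ge_entropy:
  fixes l c d :: real
  assumes S: "finite S" and FG: "F \<subseteq> Pow S" "G \<subseteq> Pow S" "cancellative_pair F G"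
    and ne: "F \<noteq> {}" "G \<noteq> {}"
    and IH: "\<And>x. x \<in> S \<Longrightarrow> pair_bound (S - {x}) l c"
    and big: "exp (c * card S) < weight l F * weight l G"
    and pos: "0 < 2 * exp (- c) + l - (ln 2 - 1/2)"
    and d: "(2 * exp (- c) + l - (ln 2 - 1/2)) * d \<le> c - (2 * ln 2 - 1)"
  shows "card S * d \<le> (\<Sum>x\<in>S. occupancy l F x + occupancy l G x)"
proof -
  define R where "R = 2 * exp (- c) + l - (ln 2 - 1/2)"
  have fin: "finite F" "finite G" using S FG(1,2) by (meson finite_Pow_iff finite_subset)+
  have w: "0 < weight l F" "0 < weight l G" using weight_pos fin ne by blast+
  have "c * card S < ln (weight l F * weight l G)"
    using w big by (subst exp_less_cancel_iff[symmetric]) simp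
  then have "c * card S < ln (weight l F) + ln (weight l G)"
    using w by (simp only: ln_mult_pos)
  also have "\<dots> \<le> (2 * ln 2 - 1) * card S + R * (\<Sum>x\<in>S. occupancy l F x + occupancy l G x)"
    unfolding R_def
    by (rule ln_weight_pair_le[OF S FG ne])
      (rule pair_bound_deletion_zeros[OF S _ FG ne IH big])
  finally have "(c - (2 * ln 2 - 1)) * card S < R * (\<Sum>x\<in>S. occupancy l F x + occupancy l G x)"
    by (simp add: left_diff_distrib)
  moreover have "R * d * card S \<le> (c - (2 * ln 2 - 1)) * card S"
    using d unfolding R_def by (intro mult_right_mono) auto
  ultimately have "R * (card S * d) \<le> R * (\<Sum>x\<in>S. occupancy l F x + occupancy l G x)"
    by (simp add: mult_ac)
  then show ?thesis using pos unfolding R_def[symmetric] by simp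
qed

lemma pair_bound_mono:
  assumes "pair_bound S l c" "c \<le> d"
  shows "pair_bound S l d"
  unfolding pair_bound_def
proof (intro allI impI)
  fix F G assume "F \<subseteq> Pow S" "G \<subseteq> Pow S" "cancellative_pair F G"
  then have "weight l F * weight l G \<le> exp (c * card S)" by (rule pair_boundD[OF assms(1)])
  also have "\<dots> \<le> exp (d * card S)" using assms(2) by (simp add: mult_right_mono)
  finally show "weight l F * weight l G \<le> exp (d * card S)" .
qed

section \<open>The range \<open>ln (5/4) \<le> l \<le> ln 2\<close>\<close>

text \<open>On \<open>[ln (5/4), ln 2]\<close> the exponent is \<open>C l = 2 * ln 2 - upper_gap (ln 2 - l)\<close>. The polynomial was fitted to the
  solution of the differential equation with equality in \<open>upper_gap_flow\<close>, on the safe side of it.\<close>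
definition upper_gap :: "real \<Rightarrow> real" where
  "upper_gap x = x - x^2 / 4 - 21/500 * x^3 + x^4 / 40"

definition upper_gap' :: "real \<Rightarrow> real" where
  "upper_gap' x = 1 - x / 2 - 63/500 * x^2 + x^3 / 10"

lemma upper_gap_derivative: "(upper_gap has_real_derivative upper_gap' x) (at x)"
  unfolding upper_gap_def[abs_def] upper_gap'_def
  by (auto intro!: derivative_eq_intros)

text \<open>A polynomial majorant \<open>E\<close> makes the flow inequality polynomial. Its
  coefficients are those of the Taylor series of \<open>exp (upper_gap x)\<close>, with the cubic
  and quartic ones raised. It holds because \<open>E x * exp (- upper_gap x)\<close> starts at
  \<open>1\<close> and does not decrease.\<close>

lemma exp_upper_gap_le:
  assumes "0 \<le> x" "x \<le> 1/2"
  shows "exp (upper_gap x) \<le> 1 + x + x^2 / 4 - x^3 / 8 - 11/200 * x^4"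
proof -
  define E where "E x = 1 + x + x^2 / 4 - x^3 / 8 - 11/200 * x^4" for x :: real
  define E' where "E' x = 1 + x / 2 - 3/8 * x^2 - 11/50 * x^3" for x :: real
  have "E 0 * exp (- upper_gap 0) \<le> E x * exp (- upper_gap x)"
  proof (rule DERIV_nonneg_imp_nondecreasing[OF assms(1)])
    fix y assume y: "0 \<le> y" "y \<le> x"
    have "(E has_real_derivative E' y) (at y)"
      unfolding E_def[abs_def] E'_def by (auto intro!: derivative_eq_intros)
    then have "((\<lambda>x. E x * exp (- upper_gap x)) has_real_derivative
        (E' y - E y * upper_gap' y) * exp (- upper_gap y)) (at y)"
      by (auto intro!: derivative_eq_intros upper_gap_derivative simp: algebra_simps)
    moreover have "E' y - E y * upper_gap' y =
      y^2 * (1/1000 + y * (7/125 - 19/250 * y - 273/4000 * y^2) + 557/100000 * y^4 + 11/2000 * y^5)"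
      unfolding E_def E'_def upper_gap'_def by (simp add: field_simps eval_nat_numeral)
    moreover have "0 \<le> 7/125 - 19/250 * y - 273/4000 * y^2"
    proof -
      have "y^2 \<le> 1/2 * y" unfolding power2_eq_square using y assms by (intro mult_right_mono) auto
      then show ?thesis using y assms by linarith
    qed
    ultimately show "\<exists>z. ((\<lambda>x. E x * exp (- upper_gap x)) has_real_derivative z) (at y) \<and> 0 \<le> z"
      using y by (intro exI[of _ "(E' y - E y * upper_gap' y) * exp (- upper_gap y)"]) simp
  qed
  moreover have "E 0 * exp (- upper_gap 0) = 1"
    by (simp add: E_def upper_gap_def)
  ultimately have "1 \<le> E x / exp (upper_gap x)"
    by (simp only: exp_minus divide_inverse)
  then have "exp (upper_gap x) \<le> E x"
    by (simp only: le_divide_eq_1_pos exp_gt_zero)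
  then show ?thesis by (simp only: E_def)
qed

text \<open>With \<open>x = ln 2 - l\<close> and \<open>C l = 2 * ln 2 - upper_gap x\<close>, this
  is the slope condition of \<open>occupancy_sum_ge_entropy\<close> for
  \<open>d = upper_gap' x\<close>. The sign of \<open>upper_gap'\<close> allows the exponential to
  be replaced by its majorant.\<close>

lemma upper_gap_flow:
  assumes "0 \<le> x" "x \<le> 1/2"
  shows "(exp (upper_gap x) / 2 + 1/2 - x) * upper_gap' x \<le> 1 - upper_gap x"
    and "0 \<le> upper_gap' x"
proof -
  have x2: "x^2 \<le> 1/2 * x" unfolding power2_eq_square using assms by (intro mult_right_mono) auto
  show g: "0 \<le> upper_gap' x"
    unfolding upper_gap'_def using assms x2 zero_le_power[of x 3] by linarith
  have "(exp (upper_gap x) / 2 + 1/2 - x) * upper_gap' x \<le>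
      ((1 + x + x^2 / 4 - x^3 / 8 - 11/200 * x^4) / 2 + 1/2 - x) * upper_gap' x"
    using exp_upper_gap_le[OF assms] g by (intro mult_right_mono) auto
  moreover have "1 - upper_gap x - ((1 + x + x^2 / 4 - x^3 / 8 - 11/200 * x^4) / 2 + 1/2 - x) * upper_gap' x =
      x^2 * (1/1000 + x / 250 + x^2 * (37/1000 - 273/8000 * x) + 557/200000 * x^4 + 11/4000 * x^5)"
    unfolding upper_gap_def upper_gap'_def by (simp add: field_simps eval_nat_numeral)
  moreover have "0 \<le> 37/1000 - 273/8000 * x" using assms by linarith
  ultimately show "(exp (upper_gap x) / 2 + 1/2 - x) * upper_gap' x \<le> 1 - upper_gap x"
    using assms by (smt (verit) divide_nonneg_nonneg mult_nonneg_nonneg zero_le_power)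
qed

text \<open>The Lagrange remainder has even degree, so negative arguments are covered too.\<close>

lemma exp_ge_Taylor6: "(\<Sum>m<6. x ^ m / fact m) \<le> exp (x::real)"
proof -
  obtain t where "exp x = (\<Sum>m<6. x ^ m / fact m) + exp t / fact 6 * x ^ 6"
    using Maclaurin_exp_le[of x 6] by blast
  then show ?thesis by simp
qed

text \<open>The upper bound keeps \<open>ln 2 - l\<close> in the domain of the polynomial estimates;
  the lower bound serves the comparison at \<open>exp l = 5/4\<close>.\<close>

lemma ln_8_5_bounds: "4699/10000 \<le> ln 2 - ln (5/4 :: real)" "ln 2 - ln (5/4 :: real) \<le> 1/2"
proof -
  have eq: "ln 2 - ln (5/4) = ln (8/5 :: real)" using ln_div[of 2 "5/4 :: real"] by simp
  have "(8/5::real) \<le> exp (1/2)"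
    using exp_ge_Taylor6[of "1/2"] by (simp add: eval_nat_numeral)
  then have "ln (8/5) \<le> ln (exp (1/2 :: real))" by (subst ln_le_cancel_iff) auto
  then show "ln 2 - ln (5/4 :: real) \<le> 1/2" unfolding eq by simp
  have "(5/8::real) \<le> exp (- (4699/10000))"
    using exp_ge_Taylor6[of "- (4699/10000)"] by (simp add: eval_nat_numeral)
  then have "ln (5/8) \<le> ln (exp (- (4699/10000) :: real))" by (subst ln_le_cancel_iff) auto
  moreover have "ln (8/5 :: real) = - ln (5/8)" using ln_inverse[of "5/8 :: real"] by simp
  ultimately show "4699/10000 \<le> ln 2 - ln (5/4 :: real)" unfolding eq by simp
qed

lemma pair_bound_upper:
  fixes S :: "'a set"
  assumes "finite S" "ln (5/4) \<le> l" "l \<le> ln 2"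
  shows "pair_bound S l (2 * ln 2 - upper_gap (ln 2 - l))"
proof -
  let ?C = "\<lambda>l. 2 * ln 2 - upper_gap (ln 2 - l)"
  have range: "0 \<le> ln 2 - l" "ln 2 - l \<le> 1/2" if "ln (5/4) \<le> l" "l \<le> ln 2" for l :: real
  proof -
    show "0 \<le> ln 2 - l" "ln 2 - l \<le> 1/2" using that ln_8_5_bounds by linarith+
  qed
  have "\<forall>l. ln (5/4) \<le> l \<and> l \<le> ln 2 \<longrightarrow> pair_bound S l (?C l)"
  proof (rule pair_bound_flow[where C' = "\<lambda>l. upper_gap' (ln 2 - l)", OF assms(1)])
    fix S :: "'a set" assume "finite S"
    then show "pair_bound S (ln 2) (?C (ln 2))"
      using pair_bound_end by (simp add: upper_gap_def)
  next
    fix l :: real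
    show "(?C has_real_derivative upper_gap' (ln 2 - l)) (at l)"
      by (auto intro!: derivative_eq_intros DERIV_chain2[OF upper_gap_derivative])
  next
    fix S :: "'a set" and F G l
    assume S: "finite S" "F \<subseteq> Pow S" "G \<subseteq> Pow S" "cancellative_pair F G" "F \<noteq> {}" "G \<noteq> {}"
      and l: "ln (5/4) \<le> l" "l \<le> ln 2"
      and IH: "\<And>x. x \<in> S \<Longrightarrow> pair_bound (S - {x}) l (?C l)"
      and big: "exp (?C l * card S) < weight l F * weight l G"
    have "exp (- ?C l) = exp (upper_gap (ln 2 - l)) * exp (- 2 * ln 2)"
      by (simp add: exp_add[symmetric])
    also have "exp (- 2 * ln 2) = (1/4 :: real)"
      by (simp add: exp_minus exp_double power2_eq_square)
    finally have K: "exp (- ?C l) = exp (upper_gap (ln 2 - l)) / 4" by simp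
    have "0 < exp (upper_gap (ln 2 - l))" by simp
    then have pos: "0 < 2 * exp (- ?C l) + l - (ln 2 - 1/2)"
      unfolding K using range[OF l] by linarith
    have step: "(2 * exp (- ?C l) + l - (ln 2 - 1/2)) * upper_gap' (ln 2 - l) \<le> ?C l - (2 * ln 2 - 1)"
      unfolding K using upper_gap_flow(1)[OF range[OF l]] by (simp add: algebra_simps)
    show "card S * upper_gap' (ln 2 - l) \<le> (\<Sum>x\<in>S. occupancy l F x + occupancy l G x)"
      by (rule occupancy_sum_ge_entropy[OF S IH big pos step])
  qed
  then show ?thesis using assms by blast
qed

section \<open>The range \<open>0 \<le> l \<le> ln (5/4)\<close>\<close>

text \<open>Eliminating \<open>p + q\<close> from \<open>(Q - p) * (Q - q) \<ge> 0\<close>, where \<open>Q\<close> is the common upper bound for \<open>p\<close> and \<open>q\<close>,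
  leaves a quadratic inequality for \<open>p * q\<close> alone.\<close>
lemma mult_ge_of_constraints:
  fixes p q K A w r :: real
  assumes w: "0 < w" "w \<le> 1" and "0 \<le> p"
    and zeros: "(1 - p) * (1 - q) \<le> K"
    and ones: "q * (1 - p * (1 - w)) \<le> A" "p * (1 - q * (1 - w)) \<le> A"
    and less: "A + (1 - w) * r < 1" "1 - K - A + w * r < 1"
    and r: "r \<le> (1 - K - A + w * r) * (A + (1 - w) * r)"
  shows "r \<le> p * q"
proof (rule ccontr)
  assume "\<not> r \<le> p * q"
  then have less_r: "p * q < r" by simp
  define Q where "Q = A + (1 - w) * (p * q)"
  have pqQ: "p \<le> Q" "q \<le> Q" using ones unfolding Q_def by (simp_all add: algebra_simps)
  then have "0 \<le> (Q - p) * (Q - q)" by simp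
  then have "Q * (p + q) \<le> Q * Q + p * q" by (simp add: algebra_simps)
  moreover have "Q * (1 - K + p * q) \<le> Q * (p + q)"
    by (rule mult_left_mono) (use zeros pqQ \<open>0 \<le> p\<close> in \<open>auto simp: algebra_simps\<close>)
  ultimately have "(1 - K + p * q - Q) * Q \<le> p * q" by (simp add: algebra_simps)
  then have f: "(1 - K - A + w * (p * q)) * (A + (1 - w) * (p * q)) \<le> p * q"
    unfolding Q_def by (simp add: algebra_simps)
  \<comment> \<open>Let \<open>f s = (1 - K - A + w * s) * (A + (1 - w) * s)\<close>. Its chord
    slope between \<open>p * q\<close> and \<open>r\<close> is
    \<open>w * X + (1 - w) * Y < 1\<close>, which contradicts \<open>f (p * q) \<le> p * q\<close>
    and \<open>r \<le> f r\<close>.\<close>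
  define X where "X = A + (1 - w) * r"
  define Y where "Y = 1 - K - A + w * (p * q)"
  have "w * (p * q) < w * r" using w less_r by simp
  then have "Y < 1" unfolding Y_def using less(2) by linarith
  moreover have "X < 1" unfolding X_def by (rule less(1))
  ultimately have "w * X + (1 - w) * Y < 1" using w by (intro convex_bound_lt) auto
  then have "(r - p * q) * (w * X + (1 - w) * Y) < (r - p * q) * 1"
    using less_r by (intro mult_strict_left_mono) auto
  moreover have "(1 - K - A + w * r) * (A + (1 - w) * r) - (1 - K - A + w * (p * q)) * (A + (1 - w) * (p * q))
      = (r - p * q) * (w * X + (1 - w) * Y)"
    unfolding X_def Y_def by algebra
  ultimately have "(1 - K - A + w * r) * (A + (1 - w) * r)
      - (1 - K - A + w * (p * q)) * (A + (1 - w) * (p * q)) < r - p * q"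
    by (simp only: mult_1_right)
  then show False using f r by linarith
qed

text \<open>On \<open>[0, ln (5/4)]\<close> the exponent is \<open>C l = ln (lower_base (exp l))\<close>, and \<open>lower_prod (exp l)\<close> bounds \<open>p * q\<close> from
  below. The coefficients come from a numerical solution of \<open>lower_base_flow\<close> and \<open>lower_prod_le\<close> with equality.\<close>
definition lower_base :: "real \<Rightarrow> real" where
  "lower_base u = 11341/5000 + 739/500 * (u - 1) + 21/100 * (u - 1)^2"

definition lower_base' :: "real \<Rightarrow> real" where
  "lower_base' u = 739/500 + 21/50 * (u - 1)"

definition lower_prod :: "real \<Rightarrow> real" where
  "lower_prod u = 93/1000 + (u - 1) / 8"

text \<open>Crude margins behind the strict side conditions of
  \<open>mult_ge_of_constraints\<close>.\<close>

lemma lower_base_bounds: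
  assumes "1 \<le> u" "u \<le> 5/4"
  shows "11/5 \<le> lower_base u" "u < 4/5 * lower_base u" "lower_base u < 5"
proof -
  have "0 \<le> 739/500 * (u - 1)" using assms by simp
  then have *: "11341/5000 \<le> lower_base u" unfolding lower_base_def
    using zero_le_power2[of "u - 1"] by linarith
  then show "11/5 \<le> lower_base u" by simp
  have "u < 4/5 * (11341/5000)" using assms(2) by simp
  also have "\<dots> \<le> 4/5 * lower_base u" using * by (rule mult_left_mono) simp
  finally show "u < 4/5 * lower_base u" .
  have "739/500 * (u - 1) \<le> 739/500 * 1" "21/100 * (u - 1)^2 \<le> 21/100 * 1"
    using assms by (intro mult_left_mono power_le_one; simp)+
  then show "lower_base u < 5" unfolding lower_base_def by linarith
qed

text \<open>Divided by \<open>lower_base u\<close>, the left side is the derivative of the exponent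
  and the right side is the lower bound for \<open>p + q\<close>.\<close>

lemma lower_base_flow:
  assumes "1 \<le> u" "u \<le> 5/4"
  shows "u * lower_base' u \<le> (1 + lower_prod u) * lower_base u - 1"
proof -
  define t where "t = u - 1"
  have t: "0 \<le> t" "t \<le> 1/4" "u = 1 + t" using assms by (auto simp: t_def)
  have "(1 + lower_prod u) * lower_base u - 1 - u * lower_base' u =
      11426/10000000 + t * (979/1000000 - 572/100000 * t) + 2625/100000 * t^3"
    unfolding lower_base_def lower_base'_def lower_prod_def t(3)
    by (simp add: field_simps eval_nat_numeral)
  moreover have "t * (572/100000 * t - 979/1000000) \<le> t * (1/1000)"
    using t by (intro mult_left_mono) auto
  moreover have "0 \<le> t^3" using t by simp
  ultimately show ?thesis using t(2) unfolding right_diff_distrib by linarith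
qed

text \<open>The last hypothesis of \<open>mult_ge_of_constraints\<close> for
  \<open>K = 1 / y\<close>, \<open>A = u / y\<close>, \<open>w = 1 / u\<close>. Clearing
  denominators leaves a polynomial in \<open>t = u - 1\<close> that is nonnegative on
  \<open>[0, 1/4]\<close>.\<close>

lemma lower_prod_le:
  assumes "1 \<le> u" "u \<le> 5/4"
  shows "lower_prod u \<le> (1 - 1 / lower_base u - u / lower_base u + 1 / u * lower_prod u) *
    (u / lower_base u + (1 - 1 / u) * lower_prod u)"
proof -
  define t where "t = u - 1"
  have t: "0 \<le> t" "t \<le> 1/4" "u = 1 + t" using assms by (auto simp: t_def)
  define y where "y = lower_base u"
  define r where "r = lower_prod u"
  have y: "0 < y" using lower_base_bounds(1)[OF assms] by (simp add: y_def)
  have "(u * y - u - u^2 + r * y) * (u^2 + (u - 1) * (r * y)) - r * y^2 * u^2 = 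
    68259468/100000000000 + 297804457476/100000000000000 * t + t^2 *
     (121090750108/10000000000000 - 10769056903/1000000000000 * t - 7003731326/100000000000 * t^2 - 701570841/10000000000 * t^3
      - 210378/10000000 * t^4) + 6890625/10000000000 * t^7"
    unfolding y_def r_def lower_base_def lower_prod_def t(3)
    by (simp add: field_simps eval_nat_numeral)
  moreover have "0 \<le> 121090750108/10000000000000 - 10769056903/1000000000000 * t - 7003731326/100000000000 * t^2 - 701570841/10000000000 * t^3
      - 210378/10000000 * t^4"
  proof -
    have "t^2 \<le> (1/4)^2" "t^3 \<le> (1/4)^3" "t^4 \<le> (1/4)^4" using t by (intro power_mono; simp)+
    then show ?thesis using t by (simp add: eval_nat_numeral)
  qed
  ultimately have "0 \<le> (u * y - u - u^2 + r * y) * (u^2 + (u - 1) * (r * y)) - r * y^2 * u^2"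
    using t by simp
  also have "\<dots> = ((1 - 1 / y - u / y + 1 / u * r) * (u / y + (1 - 1 / u) * r) - r) * (y^2 * u^2)"
    using y assms by (simp add: field_simps eval_nat_numeral)
  finally have "0 * (y^2 * u^2) \<le> ((1 - 1 / y - u / y + 1 / u * r) * (u / y + (1 - 1 / u) * r) - r) * (y^2 * u^2)"
    by (simp only: mult_zero_left)
  moreover have "0 < y^2 * u^2" using y assms by simp
  ultimately have "0 \<le> (1 - 1 / y - u / y + 1 / u * r) * (u / y + (1 - 1 / u) * r) - r"
    by (simp only: mult_le_cancel_right_pos)
  then show ?thesis unfolding y_def r_def by (simp only: le_diff_eq add_0_left)
qed

text \<open>The two exponents are compared at \<open>exp l = 5/4\<close>, so that the upper range
  supplies the end bound for the lower one.\<close>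

lemma lower_base_end: "2 * ln 2 - upper_gap (ln 2 - ln (5/4)) \<le> ln (lower_base (5/4))"
proof -
  define x where "x = ln 2 - ln (5/4 :: real)"
  have x1: "4699/10000 \<le> x" and x2: "x \<le> 1/2" unfolding x_def by (fact ln_8_5_bounds)+
  have "upper_gap (4699/10000) \<le> upper_gap x"
  proof (rule DERIV_nonneg_imp_nondecreasing[OF x1])
    fix z assume "4699/10000 \<le> z" "z \<le> x"
    then show "\<exists>y. (upper_gap has_real_derivative y) (at z) \<and> 0 \<le> y"
      using upper_gap_derivative[of z] upper_gap_flow(2)[of z] x2 by auto
  qed
  \<comment> \<open>A rational number between \<open>ln (4 / lower_base (5/4))\<close> and
    \<open>upper_gap (4699/10000)\<close>.\<close>
  moreover have "823/2000 \<le> upper_gap (4699/10000)"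
    by (simp add: upper_gap_def eval_nat_numeral)
  ultimately have "exp (823/2000) \<le> exp (upper_gap x)" by simp
  moreover have "4 / lower_base (5/4) \<le> exp (823/2000)"
    using exp_ge_Taylor6[of "823/2000"] by (simp add: eval_nat_numeral lower_base_def)
  ultimately have "4 / lower_base (5/4) \<le> exp (upper_gap x)" by linarith
  then have "ln (4 / lower_base (5/4)) \<le> ln (exp (upper_gap x))"
    by (subst ln_le_cancel_iff) (auto simp: lower_base_def power2_eq_square)
  then have "ln (4 / lower_base (5/4)) \<le> upper_gap x" by simp
  moreover have "ln (4 / lower_base (5/4)) = ln 4 - ln (lower_base (5/4))"
    by (subst ln_div) (auto simp: lower_base_def power2_eq_square)
  moreover have "ln 4 = 2 * ln (2::real)" using ln_realpow[of 2 2] by simp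
  ultimately show ?thesis unfolding x_def by linarith
qed

lemma pair_bound_lower:
  fixes S :: "'a set"
  assumes "finite S" "0 \<le> l" "l \<le> ln (5/4)"
  shows "pair_bound S l (ln (lower_base (exp l)))"
proof -
  let ?C = "\<lambda>l. ln (lower_base (exp l))"
  let ?C' = "\<lambda>l. exp l * lower_base' (exp l) / lower_base (exp l)"
  have u: "1 \<le> exp l" "exp l \<le> 5/4" if "0 \<le> l" "l \<le> ln (5/4)" for l :: real
  proof -
    show "1 \<le> exp l" using that by simp
    have "exp l \<le> exp (ln (5/4))" using that(2) by (simp only: exp_le_cancel_iff)
    then show "exp l \<le> 5/4" by simp
  qed
  have "\<forall>l. 0 \<le> l \<and> l \<le> ln (5/4) \<longrightarrow> pair_bound S l (?C l)"
  proof (rule pair_bound_flow[where C' = ?C', OF assms(1)])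
    fix S :: "'a set" assume "finite S"
    then show "pair_bound S (ln (5/4)) (?C (ln (5/4)))"
      using pair_bound_mono[OF pair_bound_upper, of S "ln (5/4)"] lower_base_end by simp
  next
    fix l :: real assume l: "0 \<le> l" "l \<le> ln (5/4)"
    have "(lower_base has_real_derivative lower_base' (exp l)) (at (exp l))"
      unfolding lower_base_def[abs_def] lower_base'_def by (auto intro!: derivative_eq_intros)
    from DERIV_chain2[OF this DERIV_exp]
    have "((\<lambda>l. lower_base (exp l)) has_real_derivative lower_base' (exp l) * exp l) (at l)" .
    moreover have "0 < lower_base (exp l)" using lower_base_bounds(1)[OF u[OF l]] by linarith
    ultimately show "(?C has_real_derivative ?C' l) (at l)"
      by (auto intro!: derivative_eq_intros simp: mult.commute)
  next
    fix S :: "'a set" and F G l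
    assume S: "finite S" "F \<subseteq> Pow S" "G \<subseteq> Pow S" "cancellative_pair F G" "F \<noteq> {}" "G \<noteq> {}"
      and l: "0 \<le> l" "l \<le> ln (5/4)"
      and IH: "\<And>x. x \<in> S \<Longrightarrow> pair_bound (S - {x}) l (?C l)"
      and big: "exp (?C l * card S) < weight l F * weight l G"
    define v where "v = exp l"
    define y where "y = lower_base v"
    define r where "r = lower_prod v"
    have v: "1 \<le> v" "v \<le> 5/4" using u[OF l] by (auto simp: v_def)
    have y: "11/5 \<le> y" "v < 4/5 * y" "y < 5" using lower_base_bounds[OF v] by (auto simp: y_def)
    have fin: "finite F" "finite G" using S(1-3) by (meson finite_Pow_iff finite_subset)+
    have K: "exp (- ?C l) = 1 / y"
    proof -
      have "0 < y" using y(1) by linarith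
      then show ?thesis
        unfolding v_def[symmetric] y_def[symmetric]
        by (simp only: exp_minus exp_ln inverse_eq_divide)
    qed
    have w: "exp (- l) = 1 / v" unfolding v_def by (simp only: exp_minus inverse_eq_divide)
    have r_bounds: "0 \<le> r" "r \<le> 1/8"
      using v by (simp_all add: r_def lower_prod_def field_simps)
    \<comment> \<open>Expanding the inequality for members avoiding \<open>x\<close> gives
      \<open>p + q \<ge> 1 - 1 / y + p * q\<close>, so a lower bound for \<open>p * q\<close> is
      enough.\<close>
    have pair: "1 - 1 / y + r \<le> occupancy l F x + occupancy l G x" if x: "x \<in> S" for x
    proof -
      define p where "p = occupancy l F x"
      define q where "q = occupancy l G x"
      have zeros: "(1 - p) * (1 - q) \<le> 1 / y"
        using pair_bound_deletion_zeros[OF S(1) x S(2-6) IH[OF x] big] by (simp only: K p_def q_def)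
      have "r \<le> p * q"
      proof (rule mult_ge_of_constraints[OF _ _ _ zeros])
        show "0 < 1 / v" "1 / v \<le> 1" using v by auto
        show "0 \<le> p" using occupancy_bounds[OF fin(1)] by (simp add: p_def)
        show "q * (1 - p * (1 - 1 / v)) \<le> v / y"
          using pair_bound_deletion_one[OF S(1) x S(2-6) IH[OF x] big]
          by (simp only: K w p_def q_def v_def times_divide_eq_right mult_1_right)
        \<comment> \<open>The second bound comes from exchanging the two families.\<close>
        have "cancellative_pair G F" using S(4) by (rule cancellative_pair_commute)
        moreover have "exp (?C l * card S) < weight l G * weight l F"
          using big by (simp only: mult.commute)
        ultimately show "p * (1 - q * (1 - 1 / v)) \<le> v / y"
          using pair_bound_deletion_one[OF S(1) x S(3,2) _ S(6,5) IH[OF x]]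
          by (simp only: K w p_def q_def v_def times_divide_eq_right mult_1_right)
        have "v / y < 4/5" using y by (simp add: divide_less_eq)
        moreover have "(1 - 1 / v) * r \<le> 1 * r"
          using v r_bounds by (intro mult_right_mono) auto
        ultimately show "v / y + (1 - 1 / v) * r < 1" using r_bounds by linarith
        have "1 / v * r \<le> 1 * r" using v r_bounds by (intro mult_right_mono) auto
        moreover have "1/5 < v / y"
          using v y by (simp add: less_divide_eq)
        moreover have "0 < 1 / y" using y by simp
        ultimately show "1 - 1 / y - v / y + 1 / v * r < 1" using r_bounds by linarith
        show "r \<le> (1 - 1 / y - v / y + 1 / v * r) * (v / y + (1 - 1 / v) * r)"
          using lower_prod_le[OF v] unfolding y_def r_def .
      qed
      then show ?thesis using zeros unfolding p_def q_def by (simp add: algebra_simps)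
    qed
    have "v * lower_base' v \<le> (1 + r) * y - 1"
      using lower_base_flow[OF v] by (simp add: r_def y_def)
    then have "v * lower_base' v / y \<le> 1 - 1 / y + r"
      using y by (simp add: field_simps)
    then have "card S * ?C' l \<le> card S * (1 - 1 / y + r)"
      unfolding y_def v_def by (intro mult_left_mono) auto
    also have "\<dots> \<le> (\<Sum>x\<in>S. occupancy l F x + occupancy l G x)"
      using pair by (intro sum_bounded_below)
    finally show "card S * ?C' l \<le> (\<Sum>x\<in>S. occupancy l F x + occupancy l G x)" .
  qed
  then show ?thesis using assms by blast
qed

theorem theorem5:
  fixes S :: "'a set" and n :: nat and \<A> \<B> :: "'a set set"
  assumes "finite S" and "card S = n"
    and "\<A> \<subseteq> Pow S" and "\<B> \<subseteq> Pow S"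
    and "cancellative_pair \<A> \<B>"
  shows "real (card \<A>) * real (card \<B>) \<le> (2.2682 :: real) ^ n"
proof -
  \<comment> \<open>At \<open>l = 0\<close> weights are cardinalities, and
    \<open>lower_base 1 = 11341/5000 = 2.2682\<close>.\<close>
  have "pair_bound S 0 (ln (lower_base (exp 0)))"
    by (rule pair_bound_lower) (use assms(1) in auto)
  then have "weight 0 \<A> * weight 0 \<B> \<le> exp (ln (2.2682) * card S)"
    using pair_boundD[OF _ assms(3-5)] by (simp add: lower_base_def)
  also have "exp (ln (2.2682 :: real) * card S) = 2.2682 ^ card S"
    by (subst mult.commute) (simp add: exp_of_nat_mult)
  finally show ?thesis using assms(2) by (simp add: weight_def)
qed

end
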